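(* Assume the following. (i) $\mathbb E\,\psi(0,Y)<\infty$ and, for all $F\in L^2(\mu_X)$, there exists $\delta>0$ such that $$\sup_{G\in L^2(\mu_X):\,\|G-F\|_{\mu_X}\le\delta}\big(\mathbb E|\partial_x^-\psi(G(X),Y)|^2+\mathbb E|\partial_x^+\psi(G(X),Y)|^2\big)<\infty .$$ (ii) There exists a constant $L>0$ such that, for all $(x_1,x_2)\in\mathbb R^2$, $|\mathbb E(\xi(x_1,Y)-\xi(x_2,Y)\mid X)|\le L|x_1-x_2|$. Let $(F_t)_{t\ge0}$ be produced by Algorithm 1 (described in the context), with step sizes given by an arbitrary $w_0>0$ and $$w_{t+1}=\min\big(w_t,\,-(2L)^{-1}\mathbb E\,\xi(F_t(X),Y)f_{t+1}(X)\big),\quad t\ge0 .$$ Then $$\lim_{t\to\infty}C(F_t)=\inf_{F\in\mathrm{lin}(\mathcal F)}C(F).$$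
   Context: $\mathcal X$ is a Borel subset of $\mathbb R^d$ and $\mathcal Y\subset\mathbb R$ (a finite set of labels, or a general subset of $\mathbb R$). $(X,Y)$ is a random pair in $\mathcal X\times\mathcal Y$ with arbitrary distribution $\mu_{X,Y}$; $\mu_X$ is the law of $X$; $L^2(\mu_X)$ is the space of measurable $f:\mathcal X\to\mathbb R$ with $\int|f|^2\,d\mu_X<\infty$, with norm $\|\cdot\|_{\mu_X}$. The loss $\psi:\mathbb R\times\mathcal Y\to[0,\infty)$ is measurable and convex in its first argument; $\partial_x^-\psi,\partial_x^+\psi$ are its left and right partial derivatives in the first argument, and $\xi(\cdot,y)$ is a fixed choice of subgradient of $\psi(\cdot,y)$, i.e. $\xi(x,y)\in[\partial_x^-\psi(x,y),\partial_x^+\psi(x,y)]$, with $\xi$ measurable. The risk functional is $C(F)=\mathbb E\,\psi(F(X),Y)$. $\mathcal F\subset L^2(\mu_X)$ is a class of functions such that $0\in\mathcal F$, $f\in\mathcal F\Leftrightarrow -f\in\mathcal F$, and $\|f\|_{\mu_X}=1$ for every $f\in\mathcal F$, $f\ne0$. $\mathrm{lin}(\mathcal F)$ is the set of all finite linear combinations of elements of $\mathcal F$. Algorithm 1: start with $F_0\in\mathcal F$; for $t=0,1,2,\dots$ choose $$f_{t+1}\in\arg\max_{f\in\mathcal F}\,-\mathbb E\,\xi(F_t(X),Y)f(X)$$ (the maximum is assumed to be attained) and set $F_{t+1}=F_t+w_{t+1}f_{t+1}$. The algorithm is run forever. *)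

theory Defs
  imports "HOL-Probability.Probability"
begin

text \<open>
  Functions on the input set \<open>XX\<close> are total functions on the ambient Euclidean space that are
  measurable with respect to \<open>restrict_space borel XX\<close>; their values outside \<open>XX\<close> are irrelevant.
\<close>

definition law_on :: "'w measure \<Rightarrow> 'a::topological_space set \<Rightarrow> ('w \<Rightarrow> 'a) \<Rightarrow> 'a measure" where
  "law_on M XX X = distr M (restrict_space borel XX) X"

definition L2 :: "'a measure \<Rightarrow> ('a \<Rightarrow> real) set" where
  "L2 N = {f. f \<in> borel_measurable N \<and> integrable N (\<lambda>x. (f x)\<^sup>2)}"

definition L2_norm_on :: "'a measure \<Rightarrow> ('a \<Rightarrow> real) \<Rightarrow> real" where
  "L2_norm_on N f = sqrt (\<integral>x. (f x)\<^sup>2 \<partial>N)"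

definition left_deriv :: "(real \<Rightarrow> real) \<Rightarrow> real \<Rightarrow> real" where
  "left_deriv g x = Lim (at_left x) (\<lambda>u. (g u - g x) / (u - x))"

definition right_deriv :: "(real \<Rightarrow> real) \<Rightarrow> real \<Rightarrow> real" where
  "right_deriv g x = Lim (at_right x) (\<lambda>u. (g u - g x) / (u - x))"

text \<open>The loss is nonnegative, so its expectation always makes sense in \<open>[0, \<infinity>]\<close>.\<close>

definition risk ::
  "'w measure \<Rightarrow> ('w \<Rightarrow> 'a) \<Rightarrow> ('w \<Rightarrow> real) \<Rightarrow> (real \<Rightarrow> real \<Rightarrow> real) \<Rightarrow> ('a \<Rightarrow> real) \<Rightarrow> ennreal"
where
  "risk M X Y \<psi> F = (\<integral>\<^sup>+\<omega>. ennreal (\<psi> (F (X \<omega>)) (Y \<omega>)) \<partial>M)"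

definition subgrad_pairing ::
  "'w measure \<Rightarrow> ('w \<Rightarrow> 'a) \<Rightarrow> ('w \<Rightarrow> real) \<Rightarrow> (real \<Rightarrow> real \<Rightarrow> real)
    \<Rightarrow> ('a \<Rightarrow> real) \<Rightarrow> ('a \<Rightarrow> real) \<Rightarrow> real"
where
  "subgrad_pairing M X Y \<xi> F f = (\<integral>\<omega>. \<xi> (F (X \<omega>)) (Y \<omega>) * f (X \<omega>) \<partial>M)"

definition lin :: "('a \<Rightarrow> real) set \<Rightarrow> ('a \<Rightarrow> real) set" where
  "lin \<F> = {(\<lambda>x. \<Sum>f\<in>S. c f * f x) | S c. finite S \<and> S \<subseteq> \<F>}"

text \<open>
  A run \<open>(F\<^sub>t)\<close> of the boosting algorithm with directions \<open>f\<^sub>t\<close> and step sizes \<open>w\<^sub>t\<close>;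
  the value \<open>f 0\<close> plays no role.
\<close>

definition boosting_run ::
  "'w measure \<Rightarrow> ('w \<Rightarrow> 'a) \<Rightarrow> ('w \<Rightarrow> real) \<Rightarrow> (real \<Rightarrow> real \<Rightarrow> real) \<Rightarrow> ('a \<Rightarrow> real) set
    \<Rightarrow> (nat \<Rightarrow> real) \<Rightarrow> (nat \<Rightarrow> 'a \<Rightarrow> real) \<Rightarrow> (nat \<Rightarrow> 'a \<Rightarrow> real) \<Rightarrow> bool"
where
  "boosting_run M X Y \<xi> \<F> w f F \<longleftrightarrow>
     F 0 \<in> \<F> \<and>
     (\<forall>t. is_arg_max (\<lambda>g. - subgrad_pairing M X Y \<xi> (F t) g) (\<lambda>g. g \<in> \<F>) (f (Suc t)) \<and>
          F (Suc t) = (\<lambda>x. F t x + w (Suc t) * f (Suc t) x))"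

end

theory Submission
  imports Defs
begin

text \<open>
  The idea is to control the iterates through the sum of the step sizes rather than through
  compactness or a limit function. Write \<open>a\<^sub>t = - E \<xi>(F\<^sub>t(X), Y) f\<^sub>t\<^sub>+\<^sub>1(X)\<close> for the steepest
  descent slope within the class and \<open>S\<^sub>t = w\<^sub>1 + \<dots> + w\<^sub>t\<close>.

  Two estimates carry the proof. The descent estimate (\<open>expected_loss_descent\<close>) says that a step
  of length \<open>s\<close> changes the risk by its slope times \<open>s\<close> up to an error quadratic in \<open>s\<close>, as for a
  function with Lipschitz derivative, but only as an upper bound; with steps at most
  \<open>a\<^sub>t / (2 L)\<close> each iteration lowers the risk by at least \<open>w\<^sub>t\<^sub>+\<^sub>1 a\<^sub>t / 2\<close>. The convexity estimate
  (\<open>expected_loss_subgradient\<close>) bounds the excess \<open>C(F\<^sub>t) - C(G)\<close> over a competitor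
  \<open>G\<close> in the linear span by the pairing of the subgradient with \<open>F\<^sub>t - G\<close>. Both \<open>F\<^sub>t\<close> and \<open>G\<close> are
  combinations of class members, so maximality of the chosen direction bounds this pairing by
  \<open>a\<^sub>t (K + S\<^sub>t)\<close>, where \<open>K\<close> depends only on the coefficients of \<open>G\<close> (\<open>pairing_bound_lin\<close>).

  If the excess stayed above some \<open>e > 0\<close>, both estimates would be contradictory as statements about
  real sequences (\<open>boosting_recursion_gap\<close>): the summability of \<open>w\<^sub>t\<^sub>+\<^sub>1 a\<^sub>t\<close> forces \<open>S\<^sub>t\<close> to be bounded,
  bounded \<open>S\<^sub>t\<close> forces the slopes and hence the steps to stay away from zero, and then \<open>S\<^sub>t\<close> is
  unbounded.

  The delicate point is the descent estimate, because the Lipschitz hypothesis is given only for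
  constant arguments and only after conditioning on \<open>X\<close>. It is transferred to random arguments by
  rounding to a countable grid, using that \<open>\<xi>(\<cdot>, y)\<close> is increasing (\<open>subgradient_Lipschitz_mesh\<close>).
\<close>

section \<open>One-sided derivatives of convex functions\<close>

lemma tendsto_at_right_Inf_if_mono:
  fixes q :: "real \<Rightarrow> real"
  assumes mono: "\<And>u v. x < u \<Longrightarrow> u < v \<Longrightarrow> q u \<le> q v"
    and bdd: "bdd_below (q ` {x<..})"
  shows "(q \<longlongrightarrow> Inf (q ` {x<..})) (at_right x)"
proof (rule order_tendstoI)
  fix a assume a: "a < Inf (q ` {x<..})"
  have "a < q u" if "x < u" for u
    using a cInf_lower[OF _ bdd, of "q u"] that by force
  then show "eventually (\<lambda>u. a < q u) (at_right x)"
    by (auto simp: eventually_at_right_field intro: exI[of _ "x + 1"])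
next
  fix a assume a: "Inf (q ` {x<..}) < a"
  then obtain b where b: "x < b" "q b < a"
    using cInf_lessD[of "q ` {x<..}" a] by (force simp: image_iff)
  have "q u < a" if "x < u" "u < b" for u
    using mono[OF that] b by simp
  then show "eventually (\<lambda>u. q u < a) (at_right x)"
    using b(1) by (auto simp: eventually_at_right_field)
qed

lemma tendsto_at_left_if_mono:
  fixes q :: "real \<Rightarrow> real"
  assumes mono: "\<And>u v. u < v \<Longrightarrow> v < x \<Longrightarrow> q u \<le> q v"
    and bound: "\<And>u. u < x \<Longrightarrow> q u \<le> B"
  obtains l where "(q \<longlongrightarrow> l) (at_left x)" "\<And>u. u < x \<Longrightarrow> q u \<le> l"
proof -
  let ?p = "\<lambda>u. - q (- u)"
  have bdd: "bdd_below (?p ` {-x<..})"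
    by (intro bdd_belowI2[of _ "- B"]) (use bound in force)
  have "(?p \<longlongrightarrow> Inf (?p ` {-x<..})) (at_right (- x))"
    by (rule tendsto_at_right_Inf_if_mono[OF _ bdd]) (simp add: mono)
  then have "((\<lambda>u. q (- u)) \<longlongrightarrow> - Inf (?p ` {-x<..})) (at_right (- x))"
    using tendsto_minus by fastforce
  then have "(q \<longlongrightarrow> - Inf (?p ` {-x<..})) (at_left x)"
    by (simp add: filterlim_at_left_to_right[of q])
  moreover have "q u \<le> - Inf (?p ` {-x<..})" if "u < x" for u
    using cInf_lower[OF _ bdd, of "- q u"] that by (force simp: image_iff intro: bexI[of _ "- u"])
  ultimately show ?thesis using that by blast
qed

text \<open>
  The difference quotients of a convex function at \<open>x\<close> increase, so their one-sided limits at \<open>x\<close>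
  exist. Only then is the value of the total operator \<^const>\<open>Lim\<close> meaningful: the right
  derivative lies below every quotient to the right of \<open>x\<close>, the left derivative above every quotient
  to the left, and the supporting line of any slope between the two stays below the graph.
\<close>

lemma convex_subgradient_inequality:
  fixes g :: "real \<Rightarrow> real"
  assumes convex: "convex_on UNIV g"
    and k: "k \<in> {left_deriv g x..right_deriv g x}"
  shows "g x + k * (v - x) \<le> g v"
proof -
  define q where "q u = (g u - g x) / (u - x)" for u
  have flip: "(g x - g u) / (x - u) = q u" for u
    using minus_divide_divide[of "g u - g x" "u - x"] by (simp add: q_def)
  have right_mono: "q u \<le> q u'" if "x < u" "u < u'" for u u'
    using convex_on_slope_le(1)[OF convex, of x u' u] that by (simp add: flip)
  have left_mono: "q u \<le> q u'" if "u < u'" "u' < x" for u u'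
    using convex_on_slope_le(2)[OF convex, of u x u'] that by (simp add: q_def)
  have left_right: "q u \<le> q u'" if "u < x" "x < u'" for u u'
    using convex_on_slope_le[OF convex, of u u' x] that by (simp add: flip) (simp add: q_def)
  have right: "right_deriv g x \<le> q v" if "x < v"
  proof -
    have bdd: "bdd_below (q ` {x<..})"
      by (intro bdd_belowI2[of _ "q (x - 1)"]) (simp add: left_right)
    have "right_deriv g x = Inf (q ` {x<..})"
      unfolding right_deriv_def q_def[symmetric]
      by (intro tendsto_Lim tendsto_at_right_Inf_if_mono bdd right_mono) auto
    then show ?thesis
      using cInf_lower[OF _ bdd, of "q v"] that by simp
  qed
  have left: "q v \<le> left_deriv g x" if "v < x"
  proof -
    obtain l where l: "(q \<longlongrightarrow> l) (at_left x)" "\<And>u. u < x \<Longrightarrow> q u \<le> l"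
      using tendsto_at_left_if_mono[of x q "q (x + 1)"] left_mono left_right[of _ "x + 1"] by auto
    have "left_deriv g x = l"
      unfolding left_deriv_def q_def[symmetric] by (intro tendsto_Lim l) auto
    then show ?thesis
      using l(2) that by simp
  qed
  consider "v < x" | "v = x" | "x < v" by linarith
  then show ?thesis
  proof cases
    case 1
    then have "q v \<le> k" using left k by simp
    then show ?thesis using 1 by (simp add: q_def field_simps)
  next
    case 3
    then have "k \<le> q v" using right k by simp
    then show ?thesis using 3 by (simp add: q_def field_simps)
  qed simp
qed

section \<open>Integration lemmas\<close>

lemma integrable_mult_if_square_integrable:
  fixes u v :: "'w \<Rightarrow> real"
  assumes [measurable]: "u \<in> borel_measurable M" "v \<in> borel_measurable M"
    and "integrable M (\<lambda>\<omega>. (u \<omega>)\<^sup>2)" "integrable M (\<lambda>\<omega>. (v \<omega>)\<^sup>2)"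
  shows "integrable M (\<lambda>\<omega>. u \<omega> * v \<omega>)"
proof (rule Bochner_Integration.integrable_bound)
  show "integrable M (\<lambda>\<omega>. (u \<omega>)\<^sup>2 + (v \<omega>)\<^sup>2)"
    using assms by simp
  have "\<bar>a * b\<bar> \<le> \<bar>a\<^sup>2 + b\<^sup>2\<bar>" for a b :: real
    using sum_squares_bound[of "\<bar>a\<bar>" "\<bar>b\<bar>"] mult_nonneg_nonneg[of "\<bar>a\<bar>" "\<bar>b\<bar>"]
    unfolding abs_mult power2_abs by linarith
  then show "AE \<omega> in M. norm (u \<omega> * v \<omega>) \<le> norm ((u \<omega>)\<^sup>2 + (v \<omega>)\<^sup>2)"
    by simp
qed simp

text \<open>
  The fibres of \<open>\<kappa>\<close> cut the space into countably many measurable cells, and a nonnegative integral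
  is the sum of its values on the cells.
\<close>

lemma nn_integral_mono_countable_partition:
  fixes \<kappa> :: "'w \<Rightarrow> 'i::countable"
  assumes [measurable]: "u \<in> borel_measurable M" "v \<in> borel_measurable M"
    and \<kappa>[measurable]: "\<kappa> \<in> M \<rightarrow>\<^sub>M count_space UNIV"
    and cell: "\<And>i. (\<integral>\<^sup>+\<omega>. u \<omega> * indicator {i} (\<kappa> \<omega>) \<partial>M) \<le> (\<integral>\<^sup>+\<omega>. v \<omega> * indicator {i} (\<kappa> \<omega>) \<partial>M)"
  shows "(\<integral>\<^sup>+\<omega>. u \<omega> \<partial>M) \<le> (\<integral>\<^sup>+\<omega>. v \<omega> \<partial>M)"
proof -
  have split: "(\<integral>\<^sup>+\<omega>. h \<omega> \<partial>M) = (\<integral>\<^sup>+i. \<integral>\<^sup>+\<omega>. h \<omega> * indicator {i} (\<kappa> \<omega>) \<partial>M \<partial>count_space UNIV)"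
    if [measurable]: "h \<in> borel_measurable M" for h
  proof -
    have "h \<omega> = (\<integral>\<^sup>+i. h \<omega> * indicator {\<kappa> \<omega>} i \<partial>count_space UNIV)" for \<omega>
      by (subst nn_integral_cmult_indicator) auto
    also have "(\<integral>\<^sup>+i. h \<omega> * indicator {\<kappa> \<omega>} i \<partial>count_space UNIV)
        = (\<integral>\<^sup>+i. h \<omega> * indicator {i} (\<kappa> \<omega>) \<partial>count_space UNIV)" for \<omega>
      by (intro nn_integral_cong) (auto simp: indicator_def)
    finally have "(\<integral>\<^sup>+\<omega>. h \<omega> \<partial>M)
        = (\<integral>\<^sup>+\<omega>. \<integral>\<^sup>+i. h \<omega> * indicator {i} (\<kappa> \<omega>) \<partial>count_space UNIV \<partial>M)"
      by (intro nn_integral_cong)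
    also have "\<dots> = (\<integral>\<^sup>+i. \<integral>\<^sup>+\<omega>. h \<omega> * indicator {i} (\<kappa> \<omega>) \<partial>M \<partial>count_space UNIV)"
      by (intro nn_integral_count_space_nn_integral) auto
    finally show ?thesis .
  qed
  show ?thesis
    by (simp add: split[of u] split[of v] nn_integral_mono cell)
qed

text \<open>
  Splitting by the sign of \<open>k\<close> bounds \<open>k\<^sup>2\<close> by one endpoint at a time, so the integral of \<open>k\<^sup>2\<close> is
  the sum of two integrals with measurable integrands. Bounding \<open>k\<^sup>2\<close> by \<open>l\<^sup>2 + r\<^sup>2\<close> instead would
  call for the measurability of the one-sided derivatives in order to split the integral of the sum.
\<close>

lemma square_le_if_between:
  fixes k l r :: real
  assumes "k \<in> {l..r}"
  shows "k\<^sup>2 * indicator {0..} k \<le> \<bar>r\<bar>\<^sup>2" "k\<^sup>2 * indicator {..<0} k \<le> \<bar>l\<bar>\<^sup>2"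
  using assms by (auto simp: indicator_def abs_le_square_iff[symmetric])

text \<open>
  The function \<open>G\<close> lies in each of the balls around itself, so the supremum bounds the term of \<open>G\<close>.
\<close>

lemma subgradient_square_integrable:
  fixes \<psi> \<xi> :: "real \<Rightarrow> real \<Rightarrow> real"
  assumes X[measurable]: "X \<in> M \<rightarrow>\<^sub>M restrict_space borel XX"
    and Y[measurable]: "Y \<in> M \<rightarrow>\<^sub>M restrict_space borel YY"
    and [measurable]: "(\<lambda>(x, y). \<xi> x y) \<in> borel_measurable (borel \<Otimes>\<^sub>M restrict_space borel YY)"
    and between: "\<And>x y. y \<in> YY \<Longrightarrow> \<xi> x y \<in> {left_deriv (\<lambda>u. \<psi> u y) x .. right_deriv (\<lambda>u. \<psi> u y) x}"
    and G: "G \<in> L2 (law_on M XX X)"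
    and bounded: "\<exists>\<delta>>0.
         (SUP G'\<in>{G' \<in> L2 (law_on M XX X). L2_norm_on (law_on M XX X) (\<lambda>x. G' x - G x) \<le> \<delta>}.
            (\<integral>\<^sup>+\<omega>. ennreal (\<bar>left_deriv (\<lambda>u. \<psi> u (Y \<omega>)) (G' (X \<omega>))\<bar>\<^sup>2) \<partial>M)
          + (\<integral>\<^sup>+\<omega>. ennreal (\<bar>right_deriv (\<lambda>u. \<psi> u (Y \<omega>)) (G' (X \<omega>))\<bar>\<^sup>2) \<partial>M)) < \<infinity>"
  shows "integrable M (\<lambda>\<omega>. (\<xi> (G (X \<omega>)) (Y \<omega>))\<^sup>2)"
proof -
  let ?l = "\<lambda>\<omega>. left_deriv (\<lambda>u. \<psi> u (Y \<omega>)) (G (X \<omega>))"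
  let ?r = "\<lambda>\<omega>. right_deriv (\<lambda>u. \<psi> u (Y \<omega>)) (G (X \<omega>))"
  let ?k = "\<lambda>\<omega>. \<xi> (G (X \<omega>)) (Y \<omega>)"
  have [measurable]: "G \<in> borel_measurable (restrict_space borel XX)"
    using G by (simp add: L2_def law_on_def)
  have k[measurable]: "?k \<in> borel_measurable M" by measurable
  have Y_in: "Y \<omega> \<in> YY" if "\<omega> \<in> space M" for \<omega>
    using measurable_space[OF Y that] by (simp add: space_restrict_space)
  obtain \<delta> where "0 < \<delta>" and finite:
    "(SUP G'\<in>{G' \<in> L2 (law_on M XX X). L2_norm_on (law_on M XX X) (\<lambda>x. G' x - G x) \<le> \<delta>}.
            (\<integral>\<^sup>+\<omega>. ennreal (\<bar>left_deriv (\<lambda>u. \<psi> u (Y \<omega>)) (G' (X \<omega>))\<bar>\<^sup>2) \<partial>M)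
          + (\<integral>\<^sup>+\<omega>. ennreal (\<bar>right_deriv (\<lambda>u. \<psi> u (Y \<omega>)) (G' (X \<omega>))\<bar>\<^sup>2) \<partial>M)) < \<infinity>"
    using bounded by blast
  have "(\<integral>\<^sup>+\<omega>. ennreal ((?k \<omega>)\<^sup>2) \<partial>M)
      = (\<integral>\<^sup>+\<omega>. ennreal ((?k \<omega>)\<^sup>2 * indicator {..<0} (?k \<omega>)) + ennreal ((?k \<omega>)\<^sup>2 * indicator {0..} (?k \<omega>)) \<partial>M)"
    by (intro nn_integral_cong) (simp add: indicator_def)
  also have "\<dots> = (\<integral>\<^sup>+\<omega>. ennreal ((?k \<omega>)\<^sup>2 * indicator {..<0} (?k \<omega>)) \<partial>M)
      + (\<integral>\<^sup>+\<omega>. ennreal ((?k \<omega>)\<^sup>2 * indicator {0..} (?k \<omega>)) \<partial>M)"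
    by (intro nn_integral_add) measurable
  also have "\<dots> \<le> (\<integral>\<^sup>+\<omega>. ennreal (\<bar>?l \<omega>\<bar>\<^sup>2) \<partial>M) + (\<integral>\<^sup>+\<omega>. ennreal (\<bar>?r \<omega>\<bar>\<^sup>2) \<partial>M)"
    by (intro add_mono nn_integral_mono ennreal_leI square_le_if_between[OF between] Y_in)
  also have "\<dots> < \<infinity>"
    using G \<open>0 < \<delta>\<close> by (intro le_less_trans[OF SUP_upper finite]) (simp add: L2_norm_on_def)
  finally show ?thesis
    by (intro integrableI_nonneg) auto
qed

section \<open>The risk functional and its subgradient\<close>

text \<open>
  The analytic situation after the one-sided derivatives have been eliminated: all that remains of
  convexity is the subgradient inequality, and all that remains of local boundedness is that
  \<open>\<xi>(G(X), Y)\<close> is square integrable. The linear form sending \<open>h\<close> to \<open>E \<xi>(G(X), Y) h(X)\<close> is then a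
  subgradient of the risk at \<open>G\<close>.
\<close>

locale convex_risk = prob_space M for M :: "'w measure" +
  fixes XX :: "'a::topological_space set" and YY :: "real set"
    and X :: "'w \<Rightarrow> 'a" and Y :: "'w \<Rightarrow> real"
    and \<psi> \<xi> :: "real \<Rightarrow> real \<Rightarrow> real"
    and L :: real
  assumes X [measurable]: "X \<in> M \<rightarrow>\<^sub>M restrict_space borel XX"
    and Y [measurable]: "Y \<in> M \<rightarrow>\<^sub>M restrict_space borel YY"
    and psi_measurable [measurable]:
      "(\<lambda>(x, y). \<psi> x y) \<in> borel_measurable (borel \<Otimes>\<^sub>M restrict_space borel YY)"
    and psi_nonneg: "\<And>x y. y \<in> YY \<Longrightarrow> 0 \<le> \<psi> x y"
    and xi_measurable [measurable]:
      "(\<lambda>(x, y). \<xi> x y) \<in> borel_measurable (borel \<Otimes>\<^sub>M restrict_space borel YY)"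
    and subgradient: "\<And>x y v. y \<in> YY \<Longrightarrow> \<psi> x y + \<xi> x y * (v - x) \<le> \<psi> v y"
    and loss_zero: "(\<integral>\<^sup>+\<omega>. ennreal (\<psi> 0 (Y \<omega>)) \<partial>M) < \<infinity>"
    and xi_square: "\<And>G. G \<in> L2 (law_on M XX X) \<Longrightarrow> integrable M (\<lambda>\<omega>. (\<xi> (G (X \<omega>)) (Y \<omega>))\<^sup>2)"
    and L_pos: "0 < L"
    and conditional_Lipschitz: "\<And>x1 x2. AE \<omega> in M.
         \<bar>real_cond_exp M (vimage_algebra (space M) X (restrict_space borel XX))
            (\<lambda>\<omega>. \<xi> x1 (Y \<omega>) - \<xi> x2 (Y \<omega>)) \<omega>\<bar> \<le> L * \<bar>x1 - x2\<bar>"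
begin

abbreviation L2_X :: "('a \<Rightarrow> real) set" where
  "L2_X \<equiv> L2 (law_on M XX X)"

abbreviation pairing :: "('a \<Rightarrow> real) \<Rightarrow> ('a \<Rightarrow> real) \<Rightarrow> real" where
  "pairing \<equiv> subgrad_pairing M X Y \<xi>"

definition expected_loss :: "('a \<Rightarrow> real) \<Rightarrow> real" where
  "expected_loss G = (\<integral>\<omega>. \<psi> (G (X \<omega>)) (Y \<omega>) \<partial>M)"

lemma Y_in: "\<omega> \<in> space M \<Longrightarrow> Y \<omega> \<in> YY"
  using measurable_space[OF Y] by (simp add: space_restrict_space)

lemma L2_X_iff:
  "g \<in> L2_X \<longleftrightarrow> g \<in> borel_measurable (restrict_space borel XX) \<and> integrable M (\<lambda>\<omega>. (g (X \<omega>))\<^sup>2)"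
  unfolding L2_def law_on_def by (auto simp: integrable_distr_eq)

lemma L2_X_measurable: "g \<in> L2_X \<Longrightarrow> g \<in> borel_measurable (restrict_space borel XX)"
  by (simp add: L2_X_iff)

lemma L2_X_square: "g \<in> L2_X \<Longrightarrow> integrable M (\<lambda>\<omega>. (g (X \<omega>))\<^sup>2)"
  by (simp add: L2_X_iff)

lemma const_L2_X: "(\<lambda>_. a) \<in> L2_X"
  by (simp add: L2_X_iff)

lemma product_integrable:
  assumes "g \<in> L2_X" "h \<in> L2_X"
  shows "integrable M (\<lambda>\<omega>. g (X \<omega>) * h (X \<omega>))"
proof -
  note [measurable] = assms[THEN L2_X_measurable]
  show ?thesis
    by (intro integrable_mult_if_square_integrable L2_X_square assms) simp_all
qed

lemma L2_X_combination:
  assumes "g \<in> L2_X" "h \<in> L2_X"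
  shows "(\<lambda>x. a * g x + b * h x) \<in> L2_X"
proof -
  note [measurable] = assms[THEN L2_X_measurable]
  have "(\<lambda>\<omega>. (a * g (X \<omega>) + b * h (X \<omega>))\<^sup>2)
      = (\<lambda>\<omega>. a\<^sup>2 * (g (X \<omega>))\<^sup>2 + 2 * a * b * (g (X \<omega>) * h (X \<omega>)) + b\<^sup>2 * (h (X \<omega>))\<^sup>2)"
    by (simp add: fun_eq_iff power2_eq_square algebra_simps)
  then show ?thesis
    using assms by (simp add: L2_X_iff product_integrable)
qed

lemma L2_X_add_scaled: "g \<in> L2_X \<Longrightarrow> h \<in> L2_X \<Longrightarrow> (\<lambda>x. g x + b * h x) \<in> L2_X"
  using L2_X_combination[of g h 1 b] by simp

lemma L2_X_integrable:
  assumes "g \<in> L2_X"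
  shows "integrable M (\<lambda>\<omega>. g (X \<omega>))"
  using product_integrable[OF assms const_L2_X[of 1]] by simp

lemma xi_measurable_comp:
  assumes "g \<in> L2_X"
  shows "(\<lambda>\<omega>. \<xi> (g (X \<omega>)) (Y \<omega>)) \<in> borel_measurable M"
proof -
  note [measurable] = assms[THEN L2_X_measurable]
  show ?thesis by measurable
qed

lemma psi_measurable_comp:
  assumes "g \<in> L2_X"
  shows "(\<lambda>\<omega>. \<psi> (g (X \<omega>)) (Y \<omega>)) \<in> borel_measurable M"
proof -
  note [measurable] = assms[THEN L2_X_measurable]
  show ?thesis by measurable
qed

lemma pairing_integrable:
  assumes "G \<in> L2_X" "h \<in> L2_X"
  shows "integrable M (\<lambda>\<omega>. \<xi> (G (X \<omega>)) (Y \<omega>) * h (X \<omega>))"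
proof -
  note [measurable] = assms(2)[THEN L2_X_measurable] xi_measurable_comp[OF assms(1)]
  show ?thesis
    by (intro integrable_mult_if_square_integrable L2_X_square xi_square assms) simp_all
qed

lemma pairing_combination:
  assumes "G \<in> L2_X" "g \<in> L2_X" "h \<in> L2_X"
  shows "pairing G (\<lambda>x. a * g x + b * h x) = a * pairing G g + b * pairing G h"
proof -
  have "pairing G (\<lambda>x. a * g x + b * h x) = (\<integral>\<omega>. a * (\<xi> (G (X \<omega>)) (Y \<omega>) * g (X \<omega>))
      + b * (\<xi> (G (X \<omega>)) (Y \<omega>) * h (X \<omega>)) \<partial>M)"
    unfolding subgrad_pairing_def by (intro Bochner_Integration.integral_cong) (auto simp: algebra_simps)
  also have "\<dots> = a * pairing G g + b * pairing G h"
    using assms by (simp add: pairing_integrable subgrad_pairing_def)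
  finally show ?thesis .
qed

text \<open>
  The subgradient inequality at \<open>G(X)\<close>, read at the point \<open>0\<close>, bounds \<open>\<psi>(G(X), Y)\<close> by
  \<open>\<psi>(0, Y) + \<xi>(G(X), Y) G(X)\<close>, whose second term is a product of square integrable variables. Hence
  every risk that occurs is finite and real arithmetic is available.
\<close>

lemma loss_integrable:
  assumes G: "G \<in> L2_X"
  shows "integrable M (\<lambda>\<omega>. \<psi> (G (X \<omega>)) (Y \<omega>))"
proof (rule Bochner_Integration.integrable_bound)
  have "integrable M (\<lambda>\<omega>. \<psi> 0 (Y \<omega>))"
    using psi_measurable_comp[OF const_L2_X[of 0]] loss_zero
    by (intro integrableI_nonneg) (auto simp: Y_in psi_nonneg intro!: AE_I2)
  then show "integrable M (\<lambda>\<omega>. \<psi> 0 (Y \<omega>) + \<xi> (G (X \<omega>)) (Y \<omega>) * G (X \<omega>))"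
    using pairing_integrable[OF G G] by simp
  show "AE \<omega> in M. norm (\<psi> (G (X \<omega>)) (Y \<omega>)) \<le> norm (\<psi> 0 (Y \<omega>) + \<xi> (G (X \<omega>)) (Y \<omega>) * G (X \<omega>))"
  proof (rule AE_I2)
    fix \<omega> assume "\<omega> \<in> space M"
    then show "norm (\<psi> (G (X \<omega>)) (Y \<omega>)) \<le> norm (\<psi> 0 (Y \<omega>) + \<xi> (G (X \<omega>)) (Y \<omega>) * G (X \<omega>))"
      using subgradient[of "Y \<omega>" "G (X \<omega>)" 0] psi_nonneg[of "Y \<omega>" "G (X \<omega>)"] by (simp add: Y_in)
  qed
qed (rule psi_measurable_comp[OF G])

lemma risk_eq_expected_loss:
  assumes "G \<in> L2_X"
  shows "risk M X Y \<psi> G = ennreal (expected_loss G)"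
  unfolding risk_def expected_loss_def
  by (intro nn_integral_eq_integral loss_integrable assms AE_I2 psi_nonneg Y_in)

lemma expected_loss_nonneg: "0 \<le> expected_loss G"
  unfolding expected_loss_def by (intro integral_nonneg_AE AE_I2 psi_nonneg Y_in)

lemma expected_loss_subgradient:
  assumes G: "G \<in> L2_X" and H: "H \<in> L2_X"
  shows "expected_loss G + (pairing G H - pairing G G) \<le> expected_loss H"
proof -
  note int = loss_integrable[OF G] pairing_integrable[OF G G] pairing_integrable[OF G H]
  have "expected_loss G + (pairing G H - pairing G G)
      = (\<integral>\<omega>. \<psi> (G (X \<omega>)) (Y \<omega>)
          + (\<xi> (G (X \<omega>)) (Y \<omega>) * H (X \<omega>) - \<xi> (G (X \<omega>)) (Y \<omega>) * G (X \<omega>)) \<partial>M)"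
    using int by (simp add: expected_loss_def subgrad_pairing_def)
  also have "\<dots> \<le> expected_loss H"
    unfolding expected_loss_def
  proof (rule integral_mono)
    fix \<omega> assume "\<omega> \<in> space M"
    then show "\<psi> (G (X \<omega>)) (Y \<omega>)
          + (\<xi> (G (X \<omega>)) (Y \<omega>) * H (X \<omega>) - \<xi> (G (X \<omega>)) (Y \<omega>) * G (X \<omega>)) \<le> \<psi> (H (X \<omega>)) (Y \<omega>)"
      using subgradient[of "Y \<omega>" "G (X \<omega>)" "H (X \<omega>)"] by (simp add: Y_in right_diff_distrib)
  qed (use int loss_integrable[OF H] in auto)
  finally show ?thesis .
qed

text \<open>
  Monotonicity of the subgradient is what later replaces continuity when random arguments are
  approximated by discrete ones.
\<close>

lemma xi_mono:
  assumes y: "y \<in> YY" and "x \<le> v"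
  shows "\<xi> x y \<le> \<xi> v y"
proof (cases "x = v")
  case False
  have "0 \<le> (\<xi> v y - \<xi> x y) * (v - x)"
    using subgradient[OF y, of x v] subgradient[OF y, of v x] by (simp add: algebra_simps)
  then show ?thesis using False assms(2) by (simp add: zero_le_mult_iff)
qed simp

text \<open>
  A weight that is a function of \<open>X\<close> passes through the conditional expectation given \<open>X\<close>. Here the
  arguments \<open>a\<close> and \<open>b\<close> of \<open>\<xi>\<close> are still constants.
\<close>

lemma conditional_Lipschitz_weighted:
  assumes k: "k \<in> L2_X" and k_nonneg: "\<And>x. 0 \<le> k x" and "b \<le> a"
  shows "(\<integral>\<^sup>+\<omega>. ennreal (k (X \<omega>) * (\<xi> a (Y \<omega>) - \<xi> b (Y \<omega>))) \<partial>M)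
      \<le> (\<integral>\<^sup>+\<omega>. ennreal (L * (a - b) * k (X \<omega>)) \<partial>M)"
proof -
  let ?N = "restrict_space borel XX"
  let ?S = "vimage_algebra (space M) X ?N"
  let ?D = "\<lambda>\<omega>. \<xi> a (Y \<omega>) - \<xi> b (Y \<omega>)"
  have X_space: "X \<in> space M \<rightarrow> space ?N"
    using measurable_space[OF X] by blast
  have "sets ?S \<subseteq> sets M"
    unfolding sets_vimage_algebra2[OF X_space] using measurable_sets[OF X] by auto
  then interpret finite_measure_subalgebra M ?S
    by unfold_locales (simp add: subalgebra_def)
  note [measurable] = k[THEN L2_X_measurable]
    xi_measurable_comp[OF const_L2_X[of a]] xi_measurable_comp[OF const_L2_X[of b]]
  have kX: "(\<lambda>\<omega>. k (X \<omega>)) \<in> borel_measurable ?S"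
    using measurable_compose[OF measurable_vimage_algebra1[OF X_space] L2_X_measurable[OF k]] .
  have D: "?D \<in> borel_measurable M" by measurable
  have int: "integrable M (\<lambda>\<omega>. k (X \<omega>) * ?D \<omega>)"
    using pairing_integrable[OF const_L2_X[of a] k] pairing_integrable[OF const_L2_X[of b] k]
    by (simp add: right_diff_distrib mult.commute)
  have "(\<integral>\<omega>. k (X \<omega>) * ?D \<omega> \<partial>M) = (\<integral>\<omega>. k (X \<omega>) * real_cond_exp M ?S ?D \<omega> \<partial>M)"
    by (rule real_cond_exp_intg(2)[OF int kX D, symmetric])
  also have "\<dots> \<le> (\<integral>\<omega>. L * (a - b) * k (X \<omega>) \<partial>M)"
  proof (rule integral_mono_AE)
    show "AE \<omega> in M. k (X \<omega>) * real_cond_exp M ?S ?D \<omega> \<le> L * (a - b) * k (X \<omega>)"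
      using conditional_Lipschitz[of a b]
    proof eventually_elim
      case (elim \<omega>)
      then have "real_cond_exp M ?S ?D \<omega> \<le> L * (a - b)"
        using \<open>b \<le> a\<close> by simp
      from mult_left_mono[OF this k_nonneg[of "X \<omega>"]] show ?case
        by (simp add: mult_ac)
    qed
  qed (use real_cond_exp_intg(1)[OF int kX D] L2_X_integrable[OF k] in auto)
  finally have le: "(\<integral>\<omega>. k (X \<omega>) * ?D \<omega> \<partial>M) \<le> (\<integral>\<omega>. L * (a - b) * k (X \<omega>) \<partial>M)" .
  have "(\<integral>\<^sup>+\<omega>. ennreal (k (X \<omega>) * ?D \<omega>) \<partial>M) = ennreal (\<integral>\<omega>. k (X \<omega>) * ?D \<omega> \<partial>M)"
    using \<open>b \<le> a\<close>
    by (intro nn_integral_eq_integral int AE_I2 mult_nonneg_nonneg k_nonneg) (simp add: xi_mono Y_in)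
  also have "\<dots> \<le> ennreal (\<integral>\<omega>. L * (a - b) * k (X \<omega>) \<partial>M)"
    using le by (rule ennreal_leI)
  also have "\<dots> = (\<integral>\<^sup>+\<omega>. ennreal (L * (a - b) * k (X \<omega>)) \<partial>M)"
    using \<open>b \<le> a\<close> L_pos L2_X_integrable[OF k]
    by (intro nn_integral_eq_integral[symmetric]) (auto simp: k_nonneg)
  finally show ?thesis .
qed

text \<open>
  The Lipschitz hypothesis concerns constant arguments, each pair with its own exceptional null set,
  whereas the algorithm compares \<open>\<xi>\<close> at the random points \<open>G(X)\<close> and \<open>H(X)\<close>. Round the larger of
  the two up and the smaller down to multiples of a mesh size \<open>d\<close>. By monotonicity of \<open>\<xi>\<close> this can
  only enlarge the difference of the subgradients, on each of the countably many cells the rounded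
  arguments are constant, and rounding costs at most \<open>2 d\<close> in the distance.
\<close>

lemma subgradient_Lipschitz_mesh:
  assumes G: "G \<in> L2_X" and H: "H \<in> L2_X" and h: "h \<in> L2_X" and d: "0 < d"
  shows "(\<integral>\<^sup>+\<omega>. ennreal (\<bar>\<xi> (G (X \<omega>)) (Y \<omega>) - \<xi> (H (X \<omega>)) (Y \<omega>)\<bar> * \<bar>h (X \<omega>)\<bar>) \<partial>M)
      \<le> (\<integral>\<^sup>+\<omega>. ennreal (L * (\<bar>G (X \<omega>) - H (X \<omega>)\<bar> + 2 * d) * \<bar>h (X \<omega>)\<bar>) \<partial>M)"
proof -
  note [measurable] = G[THEN L2_X_measurable] H[THEN L2_X_measurable] h[THEN L2_X_measurable]
    xi_measurable_comp[OF G] xi_measurable_comp[OF H]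
  define up where "up x = \<lceil>max (G x) (H x) / d\<rceil>" for x
  define down where "down x = \<lfloor>min (G x) (H x) / d\<rfloor>" for x
  have [measurable]: "up \<in> restrict_space borel XX \<rightarrow>\<^sub>M count_space UNIV"
      "down \<in> restrict_space borel XX \<rightarrow>\<^sub>M count_space UNIV"
    unfolding up_def[abs_def] down_def[abs_def] by measurable
  have up: "max (G x) (H x) \<le> d * up x" "d * up x \<le> max (G x) (H x) + d" for x
    using d ceiling_correct[of "max (G x) (H x) / d"]
    unfolding up_def by (simp_all add: field_simps del: le_of_int_ceiling max.bounded_iff)
  have down: "d * down x \<le> min (G x) (H x)" "min (G x) (H x) \<le> d * down x + d" for x
    using d floor_correct[of "min (G x) (H x) / d"]
    unfolding down_def by (simp_all add: field_simps del: of_int_floor_le min.bounded_iff)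
  show ?thesis
  proof (rule nn_integral_mono_countable_partition[where \<kappa> = "\<lambda>\<omega>. (up (X \<omega>), down (X \<omega>))"])
    show "(\<lambda>\<omega>. (up (X \<omega>), down (X \<omega>))) \<in> M \<rightarrow>\<^sub>M count_space UNIV"
      by measurable
    fix ij :: "int \<times> int"
    obtain i j where ij: "ij = (i, j)" by fastforce
    define k where "k x = \<bar>h x\<bar> * indicator {ij} (up x, down x)" for x
    have "k \<in> borel_measurable (restrict_space borel XX)"
      unfolding k_def[abs_def] by measurable
    moreover have "integrable M (\<lambda>\<omega>. (k (X \<omega>))\<^sup>2)"
      by (rule Bochner_Integration.integrable_bound[OF L2_X_square[OF h]])
        (use calculation in \<open>auto simp: k_def indicator_def\<close>)
    ultimately have k: "k \<in> L2_X" by (simp add: L2_X_iff)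
    have k_nonneg: "0 \<le> k x" for x by (simp add: k_def)
    \<comment> \<open>Cells with \<open>i < j\<close> are empty, because the upper rounding dominates the lower one.\<close>
    show "(\<integral>\<^sup>+\<omega>. ennreal (\<bar>\<xi> (G (X \<omega>)) (Y \<omega>) - \<xi> (H (X \<omega>)) (Y \<omega>)\<bar> * \<bar>h (X \<omega>)\<bar>)
            * indicator {ij} (up (X \<omega>), down (X \<omega>)) \<partial>M)
        \<le> (\<integral>\<^sup>+\<omega>. ennreal (L * (\<bar>G (X \<omega>) - H (X \<omega>)\<bar> + 2 * d) * \<bar>h (X \<omega>)\<bar>)
            * indicator {ij} (up (X \<omega>), down (X \<omega>)) \<partial>M)" (is "?lhs \<le> ?rhs")
    proof (cases "j \<le> i")
      case True
      have "?lhs \<le> (\<integral>\<^sup>+\<omega>. ennreal (k (X \<omega>) * (\<xi> (d * i) (Y \<omega>) - \<xi> (d * j) (Y \<omega>))) \<partial>M)"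
      proof (rule nn_integral_mono)
        fix \<omega> assume "\<omega> \<in> space M"
        then have y: "Y \<omega> \<in> YY" by (rule Y_in)
        show "ennreal (\<bar>\<xi> (G (X \<omega>)) (Y \<omega>) - \<xi> (H (X \<omega>)) (Y \<omega>)\<bar> * \<bar>h (X \<omega>)\<bar>)
            * indicator {ij} (up (X \<omega>), down (X \<omega>))
          \<le> ennreal (k (X \<omega>) * (\<xi> (d * i) (Y \<omega>) - \<xi> (d * j) (Y \<omega>)))"
        proof (cases "(up (X \<omega>), down (X \<omega>)) = ij")
          case cell: True
          have "\<xi> (G (X \<omega>)) (Y \<omega>) \<le> \<xi> (d * i) (Y \<omega>)" "\<xi> (H (X \<omega>)) (Y \<omega>) \<le> \<xi> (d * i) (Y \<omega>)"
            using up(1)[of "X \<omega>"] cell ij by (auto intro!: xi_mono[OF y])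
          moreover have "\<xi> (d * j) (Y \<omega>) \<le> \<xi> (G (X \<omega>)) (Y \<omega>)" "\<xi> (d * j) (Y \<omega>) \<le> \<xi> (H (X \<omega>)) (Y \<omega>)"
            using down(1)[of "X \<omega>"] cell ij by (auto intro!: xi_mono[OF y])
          ultimately have "\<bar>\<xi> (G (X \<omega>)) (Y \<omega>) - \<xi> (H (X \<omega>)) (Y \<omega>)\<bar>
              \<le> \<xi> (d * i) (Y \<omega>) - \<xi> (d * j) (Y \<omega>)"
            by linarith
          from mult_right_mono[OF this, of "\<bar>h (X \<omega>)\<bar>"] show ?thesis
            using cell by (simp add: k_def ennreal_leI mult.commute)
        qed simp
      qed
      also have "\<dots> \<le> (\<integral>\<^sup>+\<omega>. ennreal (L * (d * i - d * j) * k (X \<omega>)) \<partial>M)"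
        using True d by (intro conditional_Lipschitz_weighted k k_nonneg) simp
      also have "\<dots> \<le> ?rhs"
      proof (rule nn_integral_mono)
        fix \<omega>
        show "ennreal (L * (d * i - d * j) * k (X \<omega>))
          \<le> ennreal (L * (\<bar>G (X \<omega>) - H (X \<omega>)\<bar> + 2 * d) * \<bar>h (X \<omega>)\<bar>)
            * indicator {ij} (up (X \<omega>), down (X \<omega>))"
        proof (cases "(up (X \<omega>), down (X \<omega>)) = ij")
          case cell: True
          have "d * i - d * j \<le> \<bar>G (X \<omega>) - H (X \<omega>)\<bar> + 2 * d"
            using up(2)[of "X \<omega>"] down(2)[of "X \<omega>"] cell ij by auto
          then have "L * (d * i - d * j) * \<bar>h (X \<omega>)\<bar> \<le> L * (\<bar>G (X \<omega>) - H (X \<omega>)\<bar> + 2 * d) * \<bar>h (X \<omega>)\<bar>"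
            using L_pos by (intro mult_right_mono mult_left_mono) auto
          then show ?thesis
            using cell by (simp add: k_def ennreal_leI)
        qed (simp add: k_def)
      qed
      finally show ?thesis .
    next
      case False
      have "j \<le> i" if "(up x, down x) = ij" for x
      proof -
        have "d * down x \<le> d * up x"
          using up(1)[of x] down(1)[of x] by linarith
        then show ?thesis using that ij d by simp
      qed
      then have "indicator {ij} (up x, down x) = (0 :: ennreal)" for x
        using False by (auto simp: indicator_def)
      then show ?thesis by simp
    qed
  qed measurable
qed

text \<open>
  The limit of the previous estimate as the mesh size tends to \<open>0\<close>.
\<close>

lemma subgradient_Lipschitz:
  assumes G: "G \<in> L2_X" and H: "H \<in> L2_X" and h: "h \<in> L2_X"
  shows "(\<integral>\<omega>. \<bar>\<xi> (G (X \<omega>)) (Y \<omega>) - \<xi> (H (X \<omega>)) (Y \<omega>)\<bar> * \<bar>h (X \<omega>)\<bar> \<partial>M)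
      \<le> L * (\<integral>\<omega>. \<bar>G (X \<omega>) - H (X \<omega>)\<bar> * \<bar>h (X \<omega>)\<bar> \<partial>M)" (is "?A \<le> L * ?B")
proof -
  let ?D = "\<lambda>\<omega>. \<bar>\<xi> (G (X \<omega>)) (Y \<omega>) - \<xi> (H (X \<omega>)) (Y \<omega>)\<bar> * \<bar>h (X \<omega>)\<bar>"
  define c where "c = (\<integral>\<omega>. \<bar>h (X \<omega>)\<bar> \<partial>M)"
  have c_nonneg: "0 \<le> c" by (simp add: c_def)
  have intD: "integrable M ?D"
    using integrable_abs[OF Bochner_Integration.integrable_diff[OF pairing_integrable[OF G h] pairing_integrable[OF H h]]]
    by (simp add: abs_mult left_diff_distrib[symmetric])
  have intB: "integrable M (\<lambda>\<omega>. \<bar>G (X \<omega>) - H (X \<omega>)\<bar> * \<bar>h (X \<omega>)\<bar>)"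
    using integrable_abs[OF Bochner_Integration.integrable_diff[OF product_integrable[OF G h] product_integrable[OF H h]]]
    by (simp add: abs_mult left_diff_distrib[symmetric])
  have mesh: "?A \<le> L * ?B + 2 * d * L * c" if d: "0 < d" for d
  proof -
    have int: "integrable M (\<lambda>\<omega>. L * (\<bar>G (X \<omega>) - H (X \<omega>)\<bar> + 2 * d) * \<bar>h (X \<omega>)\<bar>)"
      using intB L2_X_integrable[OF h] by (simp add: distrib_left distrib_right mult.assoc)
    have "ennreal ?A = (\<integral>\<^sup>+\<omega>. ennreal (?D \<omega>) \<partial>M)"
      by (intro nn_integral_eq_integral[symmetric] intD) simp
    also have "\<dots> \<le> (\<integral>\<^sup>+\<omega>. ennreal (L * (\<bar>G (X \<omega>) - H (X \<omega>)\<bar> + 2 * d) * \<bar>h (X \<omega>)\<bar>) \<partial>M)"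
      by (rule subgradient_Lipschitz_mesh[OF G H h d])
    also have "\<dots> = ennreal (\<integral>\<omega>. L * (\<bar>G (X \<omega>) - H (X \<omega>)\<bar> + 2 * d) * \<bar>h (X \<omega>)\<bar> \<partial>M)"
      using L_pos d by (intro nn_integral_eq_integral int) simp
    finally have "?A \<le> (\<integral>\<omega>. L * (\<bar>G (X \<omega>) - H (X \<omega>)\<bar> + 2 * d) * \<bar>h (X \<omega>)\<bar> \<partial>M)"
      using L_pos d by (subst (asm) ennreal_le_iff) (auto intro!: integral_nonneg_AE)
    also have "\<dots> = L * ?B + 2 * d * L * c"
    proof -
      have "(\<integral>\<omega>. L * (\<bar>G (X \<omega>) - H (X \<omega>)\<bar> + 2 * d) * \<bar>h (X \<omega>)\<bar> \<partial>M)
         = (\<integral>\<omega>. L * (\<bar>G (X \<omega>) - H (X \<omega>)\<bar> * \<bar>h (X \<omega>)\<bar>) + 2 * d * L * \<bar>h (X \<omega>)\<bar> \<partial>M)"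
        by (intro Bochner_Integration.integral_cong) (auto simp: algebra_simps)
      also have "\<dots> = L * ?B + 2 * d * L * c"
        using intB L2_X_integrable[OF h] by (simp add: c_def)
      finally show ?thesis .
    qed
    finally show ?thesis .
  qed
  show ?thesis
  proof (rule field_le_epsilon)
    fix e :: real assume e: "0 < e"
    define m where "m = c + 1"
    have m: "0 < m" "c \<le> m" using c_nonneg by (simp_all add: m_def)
    have "2 * (e / (2 * L * m)) * L * c = e * (c / m)"
      using L_pos m by simp
    also have "\<dots> \<le> e"
      using m e by (intro mult_left_le) auto
    finally show "?A \<le> L * ?B + e"
      using mesh[of "e / (2 * L * m)"] e L_pos m by simp
  qed
qed

text \<open>
  Convexity, applied at the new point \<open>G + s h\<close>, bounds the increment of the risk by
  \<open>s E \<xi>((G + s h)(X), Y) h(X)\<close>. Moving the subgradient back to \<open>G\<close> costs at most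
  \<open>L s\<^sup>2 E h(X)\<^sup>2\<close> by the Lipschitz estimate. The loss need not be differentiable.
\<close>

lemma expected_loss_descent:
  assumes G: "G \<in> L2_X" and h: "h \<in> L2_X"
  shows "expected_loss (\<lambda>x. G x + s * h x)
      \<le> expected_loss G + s * pairing G h + L * s\<^sup>2 * (\<integral>\<omega>. (h (X \<omega>))\<^sup>2 \<partial>M)"
proof -
  define H where "H x = G x + s * h x" for x
  have H: "H \<in> L2_X"
    unfolding H_def[abs_def] by (rule L2_X_add_scaled[OF G h])
  have "pairing H H - pairing H G = s * pairing H h"
    using pairing_combination[OF H G h, of 1 s] by (simp add: H_def[abs_def])
  then have "expected_loss H \<le> expected_loss G + s * pairing H h"
    using expected_loss_subgradient[OF H G] by simp
  also have "s * pairing H h \<le> s * pairing G h + L * s\<^sup>2 * (\<integral>\<omega>. (h (X \<omega>))\<^sup>2 \<partial>M)"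
  proof -
    let ?d = "\<lambda>\<omega>. \<xi> (H (X \<omega>)) (Y \<omega>) - \<xi> (G (X \<omega>)) (Y \<omega>)"
    have "pairing H h - pairing G h = (\<integral>\<omega>. ?d \<omega> * h (X \<omega>) \<partial>M)"
      using pairing_integrable[OF H h] pairing_integrable[OF G h]
      by (simp add: subgrad_pairing_def left_diff_distrib)
    then have "\<bar>pairing H h - pairing G h\<bar> \<le> (\<integral>\<omega>. \<bar>?d \<omega>\<bar> * \<bar>h (X \<omega>)\<bar> \<partial>M)"
      using integral_abs_bound[of M "\<lambda>\<omega>. ?d \<omega> * h (X \<omega>)"] by (simp add: abs_mult)
    also have "\<dots> \<le> L * (\<integral>\<omega>. \<bar>H (X \<omega>) - G (X \<omega>)\<bar> * \<bar>h (X \<omega>)\<bar> \<partial>M)"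
      by (rule subgradient_Lipschitz[OF H G h])
    also have "\<dots> = L * (\<bar>s\<bar> * (\<integral>\<omega>. (h (X \<omega>))\<^sup>2 \<partial>M))"
      by (simp add: H_def abs_mult power2_eq_square mult.assoc flip: Bochner_Integration.integral_mult_right_zero)
    finally have diff: "\<bar>pairing H h - pairing G h\<bar> \<le> L * (\<bar>s\<bar> * (\<integral>\<omega>. (h (X \<omega>))\<^sup>2 \<partial>M))" .
    have "s * (pairing H h - pairing G h) \<le> \<bar>s\<bar> * \<bar>pairing H h - pairing G h\<bar>"
      by (metis abs_ge_self abs_mult)
    also have "\<dots> \<le> \<bar>s\<bar> * (L * (\<bar>s\<bar> * (\<integral>\<omega>. (h (X \<omega>))\<^sup>2 \<partial>M)))"
      by (intro mult_left_mono diff) simp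
    also have "\<dots> = L * s\<^sup>2 * (\<integral>\<omega>. (h (X \<omega>))\<^sup>2 \<partial>M)"
      using abs_mult_self_eq[of s] by (simp add: power2_eq_square mult_ac)
    finally show ?thesis by (simp add: right_diff_distrib)
  qed
  finally show ?thesis by (simp add: H_def[abs_def])
qed

text \<open>
  The zero element of the class is exempt from the normalisation, so the second moment of a
  direction is \<open>0\<close> or \<open>1\<close>.
\<close>

lemma second_moment_le_one:
  assumes "\<not> (AE x in law_on M XX X. g x = 0) \<Longrightarrow> L2_norm_on (law_on M XX X) g = 1"
    and g: "g \<in> L2_X"
  shows "(\<integral>\<omega>. (g (X \<omega>))\<^sup>2 \<partial>M) \<le> 1"
proof -
  note [measurable] = g[THEN L2_X_measurable]
  have "(\<integral>\<omega>. (g (X \<omega>))\<^sup>2 \<partial>M) = (\<integral>x. (g x)\<^sup>2 \<partial>law_on M XX X)"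
    unfolding law_on_def by (subst integral_distr) auto
  also have "\<dots> \<le> 1"
  proof (cases "AE x in law_on M XX X. g x = 0")
    case True
    then have "(\<integral>x. (g x)\<^sup>2 \<partial>law_on M XX X) = 0"
      by (intro integral_eq_zero_AE) auto
    then show ?thesis by simp
  next
    case False
    then show ?thesis using assms(1) by (simp add: L2_norm_on_def)
  qed
  finally show ?thesis .
qed

text \<open>
  This turns the maximality of the chosen direction within \<open>\<F>\<close> into a bound on all of
  \<^term>\<open>lin \<F>\<close>, at the price of the sum of the absolute coefficients.
\<close>

lemma pairing_bound_lin:
  assumes G: "G \<in> L2_X" and A: "\<And>g. g \<in> \<F> \<Longrightarrow> \<bar>pairing G g\<bar> \<le> A"
    and S: "finite S" "S \<subseteq> \<F>" "\<F> \<subseteq> L2_X"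
  shows "(\<lambda>x. \<Sum>g\<in>S. c g * g x) \<in> L2_X
    \<and> \<bar>pairing G (\<lambda>x. \<Sum>g\<in>S. c g * g x)\<bar> \<le> A * (\<Sum>g\<in>S. \<bar>c g\<bar>)"
  using S(1,2)
proof (induction S rule: finite_induct)
  case empty
  then show ?case by (simp add: const_L2_X subgrad_pairing_def)
next
  case (insert g S)
  let ?h = "\<lambda>x. \<Sum>g\<in>S. c g * g x"
  have g: "g \<in> \<F>" "g \<in> L2_X" and h: "?h \<in> L2_X" and IH: "\<bar>pairing G ?h\<bar> \<le> A * (\<Sum>g\<in>S. \<bar>c g\<bar>)"
    using insert S(3) by auto
  have eq: "(\<lambda>x. \<Sum>g\<in>insert g S. c g * g x) = (\<lambda>x. c g * g x + 1 * ?h x)"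
    using insert by (simp add: fun_eq_iff)
  have "\<bar>c g * pairing G g\<bar> \<le> \<bar>c g\<bar> * A"
    unfolding abs_mult by (intro mult_left_mono A g) simp
  with IH have "\<bar>c g * pairing G g + 1 * pairing G ?h\<bar> \<le> A * (\<Sum>g\<in>insert g S. \<bar>c g\<bar>)"
    using insert by (simp add: algebra_simps abs_triangle_ineq[THEN order_trans])
  then show ?case
    unfolding eq pairing_combination[OF G g(2) h] using L2_X_combination[OF g(2) h] by blast
qed

end

section \<open>Convergence of the algorithm\<close>

lemma lin_member: "g \<in> \<F> \<Longrightarrow> g \<in> lin \<F>"
  unfolding lin_def by (auto intro!: exI[of _ "{g}"] exI[of _ "\<lambda>_. 1"])

lemma lin_add_scaled:
  assumes "h \<in> lin \<F>" "g \<in> \<F>"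
  shows "(\<lambda>x. h x + b * g x) \<in> lin \<F>"
proof -
  obtain S c where S: "finite S" "S \<subseteq> \<F>" and h: "h = (\<lambda>x. \<Sum>f\<in>S. c f * f x)"
    using assms(1) unfolding lin_def by auto
  define c' where "c' f = (if f \<in> S then c f else 0) + (if f = g then b else 0)" for f
  have "h x + b * g x = (\<Sum>f\<in>insert g S. c' f * f x)" for x
  proof -
    have "(\<Sum>f\<in>insert g S. c' f * f x)
        = (\<Sum>f\<in>insert g S. if f \<in> S then c f * f x else 0) + (\<Sum>f\<in>insert g S. if f = g then b * f x else 0)"
      unfolding c'_def sum.distrib[symmetric] by (intro sum.cong) (auto simp: algebra_simps)
    moreover have "(\<Sum>f\<in>insert g S. if f \<in> S then c f * f x else 0) = h x"
      unfolding h using S(1) by (intro sum.mono_neutral_cong_right) auto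
    ultimately show ?thesis
      using S(1) by simp
  qed
  then have "(\<lambda>x. h x + b * g x) = (\<lambda>x. \<Sum>f\<in>insert g S. c' f * f x)" ..
  then show ?thesis
    unfolding lin_def using S assms(2) by auto
qed

text \<open>
  Here \<open>c t\<close> stands for the current risk, \<open>a t\<close> for the steepest slope within the class, and
  \<open>e \<le> a t * (K + S t)\<close> with \<open>S t = w 1 + \<dots> + w t\<close> is what convexity gives if the risk stays \<open>e\<close>
  above a competitor. This cannot hold for all \<open>t\<close>.

  The risk is bounded below, so the total descent \<open>w (Suc t) * a t\<close> is summable, and therefore so
  is \<open>w (Suc t) / (K + S t)\<close>. The latter sum dominates the telescoping increments of
  \<open>ln (K + S t)\<close>, so \<open>S t\<close> stays bounded. But then the slopes \<open>a t\<close> stay away from \<open>0\<close>; by the rule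
  for the step sizes, which only decrease below \<open>w 0\<close> when the slope forces them to, the steps stay
  away from \<open>0\<close> as well, and their sum \<open>S t\<close> is unbounded.
\<close>

lemma boosting_recursion_gap:
  fixes a c w :: "nat \<Rightarrow> real"
  assumes L: "0 < L" and w0: "0 < w 0"
    and a_nonneg: "\<And>t. 0 \<le> a t"
    and c_nonneg: "\<And>t. 0 \<le> c t"
    and step: "\<And>t. w (Suc t) = min (w t) (a t / (2 * L))"
    and descent: "\<And>t. c (Suc t) \<le> c t - w (Suc t) * a t / 2"
    and K: "0 < K" and e: "0 < e"
  shows "\<exists>t. a t * (K + (\<Sum>s<t. w (Suc s))) < e"
proof (rule ccontr)
  define S where "S t = (\<Sum>s<t. w (Suc s))" for t
  assume "\<not> ?thesis"
  then have gap: "e \<le> a t * (K + S t)" for t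
    by (simp add: S_def not_less)
  have w_nonneg: "0 \<le> w t" for t
  proof (induction t)
    case (Suc t)
    then show ?case using step[of t] a_nonneg[of t] L by simp
  qed (use w0 in simp)
  have S_Suc: "S (Suc t) = S t + w (Suc t)" for t
    by (simp add: S_def)
  have S_nonneg: "0 \<le> S t" for t
    unfolding S_def by (intro sum_nonneg w_nonneg)
  have budget: "(\<Sum>s<t. w (Suc s) * a s) \<le> 2 * (c 0 - c t)" for t
  proof (induction t)
    case (Suc t)
    then show ?case using descent[of t] by simp
  qed simp
  have ratio: "w (Suc t) / (K + S t) \<le> w (Suc t) * a t / e" for t
  proof -
    have "w (Suc t) * e \<le> w (Suc t) * (a t * (K + S t))"
      by (intro mult_left_mono gap w_nonneg)
    then show ?thesis
      using K e S_nonneg[of t] by (simp add: field_simps)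
  qed
  have "ln (K + S t) \<le> ln K + (\<Sum>s<t. w (Suc s) * a s / e)" for t
  proof (induction t)
    case (Suc t)
    have "ln (K + S (Suc t)) - ln (K + S t) \<le> w (Suc t) / (K + S t)"
      using ln_diff_le[of "K + S (Suc t)" "K + S t"] K S_nonneg[of t] S_nonneg[of "Suc t"]
      by (simp add: S_Suc)
    with Suc ratio[of t] show ?case by simp
  qed (simp add: S_def)
  also have "ln K + (\<Sum>s<t. w (Suc s) * a s / e) \<le> ln K + 2 * c 0 / e" for t
    using divide_right_mono[OF budget[of t], of e] c_nonneg[of t] e
    by (simp add: sum_divide_distrib[symmetric] field_simps)
  finally have log_bound: "ln (K + S t) \<le> ln K + 2 * c 0 / e" for t .
  define B where "B = exp (ln K + 2 * c 0 / e)"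
  have B: "0 < B" by (simp add: B_def)
  have S_bound: "K + S t \<le> B" for t
    unfolding B_def using log_bound[of t] K S_nonneg[of t] by (simp add: ln_ge_iff[symmetric] ln_le_cancel_iff[symmetric])
  have a_bound: "e / B \<le> a t" for t
  proof -
    have "e \<le> a t * B"
      using gap[of t] mult_left_mono[OF S_bound[of t] a_nonneg[of t]] by simp
    then show ?thesis using B by (simp add: field_simps)
  qed
  define m where "m = min (w 0) (e / B / (2 * L))"
  have m: "0 < m" using w0 e B L by (simp add: m_def)
  have w_bound: "m \<le> w t" for t
  proof (induction t)
    case (Suc t)
    have "e / B / (2 * L) \<le> a t / (2 * L)"
      using a_bound[of t] L by (intro divide_right_mono) auto
    then have "m \<le> a t / (2 * L)" unfolding m_def by linarith
    then show ?case using Suc step[of t] by simp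
  qed (simp add: m_def)
  have growth: "real t * m \<le> S t" for t
    unfolding S_def using sum_bounded_below[of "{..<t}" m "\<lambda>s. w (Suc s)"] w_bound by simp
  obtain n where "B < real n * m"
    using reals_Archimedean3[OF m] by blast
  then show False
    using growth[of n] S_bound[of n] K by linarith
qed

theorem theorem3p1:
  fixes M :: "'w measure"
    and XX :: "(real ^ 'd) set" and YY :: "real set"
    and X :: "'w \<Rightarrow> real ^ 'd" and Y :: "'w \<Rightarrow> real"
    and \<psi> \<xi> :: "real \<Rightarrow> real \<Rightarrow> real"
    and \<F> :: "(real ^ 'd \<Rightarrow> real) set"
    and L :: real
    and w :: "nat \<Rightarrow> real"
    and f F :: "nat \<Rightarrow> real ^ 'd \<Rightarrow> real"
  assumes "prob_space M"
    and "XX \<in> sets borel"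
    and "X \<in> M \<rightarrow>\<^sub>M restrict_space borel XX"
    and "Y \<in> M \<rightarrow>\<^sub>M restrict_space borel YY"
    and psi_measurable:
      "(\<lambda>(x, y). \<psi> x y) \<in> borel_measurable (borel \<Otimes>\<^sub>M restrict_space borel YY)"
    and psi_nonneg: "\<And>x y. y \<in> YY \<Longrightarrow> 0 \<le> \<psi> x y"
    and psi_convex: "\<And>y. y \<in> YY \<Longrightarrow> convex_on UNIV (\<lambda>x. \<psi> x y)"
    and xi_measurable:
      "(\<lambda>(x, y). \<xi> x y) \<in> borel_measurable (borel \<Otimes>\<^sub>M restrict_space borel YY)"
    and xi_subgradient:
      "\<And>x y. y \<in> YY \<Longrightarrow> \<xi> x y \<in> {left_deriv (\<lambda>u. \<psi> u y) x .. right_deriv (\<lambda>u. \<psi> u y) x}"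
    and class_L2: "\<F> \<subseteq> L2 (law_on M XX X)"
    and class_zero: "(\<lambda>x. 0) \<in> \<F>"
    and class_symmetric: "\<And>g. g \<in> \<F> \<longleftrightarrow> (\<lambda>x. - g x) \<in> \<F>"
    and class_norm:
      "\<And>g. g \<in> \<F> \<Longrightarrow> \<not> (AE x in law_on M XX X. g x = 0) \<Longrightarrow> L2_norm_on (law_on M XX X) g = 1"
    and i_risk: "(\<integral>\<^sup>+\<omega>. ennreal (\<psi> 0 (Y \<omega>)) \<partial>M) < \<infinity>"
    and i_bounded:
      "\<And>H. H \<in> L2 (law_on M XX X) \<Longrightarrow> \<exists>\<delta>>0.
         (SUP G\<in>{G \<in> L2 (law_on M XX X). L2_norm_on (law_on M XX X) (\<lambda>x. G x - H x) \<le> \<delta>}.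
            (\<integral>\<^sup>+\<omega>. ennreal (\<bar>left_deriv (\<lambda>u. \<psi> u (Y \<omega>)) (G (X \<omega>))\<bar>\<^sup>2) \<partial>M)
          + (\<integral>\<^sup>+\<omega>. ennreal (\<bar>right_deriv (\<lambda>u. \<psi> u (Y \<omega>)) (G (X \<omega>))\<bar>\<^sup>2) \<partial>M)) < \<infinity>"
    and ii_L: "0 < L"
    and ii_Lipschitz:
      "\<And>x1 x2. AE \<omega> in M.
         \<bar>real_cond_exp M (vimage_algebra (space M) X (restrict_space borel XX))
            (\<lambda>\<omega>. \<xi> x1 (Y \<omega>) - \<xi> x2 (Y \<omega>)) \<omega>\<bar> \<le> L * \<bar>x1 - x2\<bar>"
    and run: "boosting_run M X Y \<xi> \<F> w f F"
    and step_init: "0 < w 0"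
    and step:
      "\<And>t. w (Suc t) = min (w t) (- inverse (2 * L) * subgrad_pairing M X Y \<xi> (F t) (f (Suc t)))"
  shows "(\<lambda>t. risk M X Y \<psi> (F t)) \<longlonglongrightarrow> (INF G\<in>lin \<F>. risk M X Y \<psi> G)"
proof -
  let ?N = "law_on M XX X"
  note X = assms(3) and Y = assms(4)
  interpret prob_space M by fact
  have xi_square: "integrable M (\<lambda>\<omega>. (\<xi> (G (X \<omega>)) (Y \<omega>))\<^sup>2)" if G: "G \<in> L2 ?N" for G
    by (rule subgradient_square_integrable[OF X Y xi_measurable xi_subgradient G i_bounded[OF G]])
  interpret convex_risk M XX YY X Y \<psi> \<xi> L
  proof unfold_locales
    show "\<psi> x y + \<xi> x y * (v - x) \<le> \<psi> v y" if "y \<in> YY" for x y v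
      by (rule convex_subgradient_inequality[OF psi_convex[OF that] xi_subgradient[OF that]])
  qed (fact X Y psi_measurable psi_nonneg xi_measurable i_risk xi_square ii_L ii_Lipschitz)+

  have F0: "F 0 \<in> \<F>"
    and argmax: "is_arg_max (\<lambda>g. - pairing (F t) g) (\<lambda>g. g \<in> \<F>) (f (Suc t))"
    and F_Suc: "F (Suc t) = (\<lambda>x. F t x + w (Suc t) * f (Suc t) x)" for t
    using run unfolding boosting_run_def by blast+
  have f: "f (Suc t) \<in> \<F>" and f_max: "g \<in> \<F> \<Longrightarrow> pairing (F t) (f (Suc t)) \<le> pairing (F t) g" for t g
    using argmax[of t] unfolding is_arg_max_linorder by auto
  have f_L2: "f (Suc t) \<in> L2_X" for t
    using f class_L2 by blast
  have F_L2: "F t \<in> L2_X" for t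
  proof (induction t)
    case 0
    then show ?case using F0 class_L2 by blast
  next
    case (Suc t)
    then show ?case unfolding F_Suc by (rule L2_X_add_scaled[OF _ f_L2])
  qed
  have F_lin: "F t \<in> lin \<F>" for t
  proof (induction t)
    case 0
    then show ?case using F0 by (rule lin_member)
  next
    case (Suc t)
    then show ?case unfolding F_Suc by (rule lin_add_scaled[OF _ f])
  qed
  have unit: "(\<integral>\<omega>. (f (Suc t) (X \<omega>))\<^sup>2 \<partial>M) \<le> 1" for t
    using class_norm[OF f] f_L2 by (rule second_moment_le_one)

  \<comment> \<open>By symmetry of the class, the maximal slope \<open>a t\<close> bounds the pairing in absolute value.\<close>
  define a where "a t = - pairing (F t) (f (Suc t))" for t
  define c where "c t = expected_loss (F t)" for t
  have a_bound: "\<bar>pairing (F t) g\<bar> \<le> a t" if "g \<in> \<F>" for t g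
  proof -
    have "pairing (F t) (\<lambda>x. - g x) = - pairing (F t) g"
      by (simp add: subgrad_pairing_def)
    then show ?thesis
      using f_max[of g t] f_max[of "\<lambda>x. - g x" t] that class_symmetric[of g] by (simp add: a_def)
  qed
  have a_nonneg: "0 \<le> a t" for t
    using a_bound[OF class_zero] by (rule order_trans[OF abs_ge_zero])
  have step': "w (Suc t) = min (w t) (a t / (2 * L))" for t
    using step[of t] by (simp add: a_def field_simps)
  have w_nonneg: "0 \<le> w t" for t
  proof (induction t)
    case (Suc t)
    then show ?case using a_nonneg[of t] L_pos by (simp add: step')
  qed (use step_init in simp)
  have descent: "c (Suc t) \<le> c t - w (Suc t) * a t / 2" for t
  proof -
    let ?s = "w (Suc t)"
    have "c (Suc t) \<le> c t + ?s * pairing (F t) (f (Suc t)) + L * ?s\<^sup>2 * (\<integral>\<omega>. (f (Suc t) (X \<omega>))\<^sup>2 \<partial>M)"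
      unfolding c_def F_Suc by (rule expected_loss_descent[OF F_L2 f_L2])
    moreover have "L * ?s\<^sup>2 * (\<integral>\<omega>. (f (Suc t) (X \<omega>))\<^sup>2 \<partial>M) \<le> L * ?s\<^sup>2"
      using L_pos by (intro mult_left_le unit) simp
    \<comment> \<open>The cap \<open>a t / (2 L)\<close> on the step makes the quadratic error at most half of the linear gain.\<close>
    moreover have "L * ?s\<^sup>2 \<le> ?s * a t / 2"
    proof -
      have "?s \<le> a t / (2 * L)" using step'[of t] by simp
      then have "L * ?s \<le> a t / 2" using L_pos by (simp add: field_simps)
      from mult_left_mono[OF this w_nonneg[of "Suc t"]] show ?thesis
        by (simp add: power2_eq_square mult_ac)
    qed
    ultimately show ?thesis by (simp add: a_def)
  qed

  \<comment> \<open>The iterate is its starting point plus steps along members of the class, so its coefficients have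
    absolute sum at most \<open>1\<close> plus the sum of the step sizes.\<close>
  have self_pairing: "\<bar>pairing G (F t)\<bar> \<le> A * (1 + (\<Sum>s<t. w (Suc s)))"
    if G: "G \<in> L2_X" and A: "\<And>g. g \<in> \<F> \<Longrightarrow> \<bar>pairing G g\<bar> \<le> A" for G A t
  proof (induction t)
    case 0
    then show ?case using A[OF F0] by simp
  next
    case (Suc t)
    have "\<bar>w (Suc t) * pairing G (f (Suc t))\<bar> \<le> w (Suc t) * A"
      using mult_left_mono[OF A[OF f] w_nonneg] w_nonneg by (simp add: abs_mult)
    moreover have "pairing G (F (Suc t)) = pairing G (F t) + w (Suc t) * pairing G (f (Suc t))"
      using pairing_combination[OF G F_L2 f_L2, of 1 t] by (simp add: F_Suc)
    ultimately show ?case using Suc by (simp add: algebra_simps)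
  qed

  \<comment> \<open>Convexity compares \<open>F t\<close> with \<open>G\<close> through the pairing with \<open>F t - G\<close> alone.\<close>
  have near_opt: "\<exists>t. c t < expected_loss G + e" if G: "G \<in> lin \<F>" and e: "0 < e" for G and e :: real
  proof -
    obtain S b where S: "finite S" "S \<subseteq> \<F>" and G_eq: "G = (\<lambda>x. \<Sum>g\<in>S. b g * g x)"
      using G unfolding lin_def by auto
    define K where "K = 1 + (\<Sum>g\<in>S. \<bar>b g\<bar>)"
    have K: "0 < K" unfolding K_def by (intro add_pos_nonneg sum_nonneg) auto
    have gap: "c t - expected_loss G \<le> a t * (K + (\<Sum>s<t. w (Suc s)))" for t
    proof -
      have G_L2: "G \<in> L2_X" and "\<bar>pairing (F t) G\<bar> \<le> a t * (\<Sum>g\<in>S. \<bar>b g\<bar>)"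
        using pairing_bound_lin[OF F_L2 a_bound S class_L2] unfolding G_eq by blast+
      moreover have "\<bar>pairing (F t) (F t)\<bar> \<le> a t * (1 + (\<Sum>s<t. w (Suc s)))"
        using self_pairing[OF F_L2 a_bound] .
      moreover have "c t + (pairing (F t) G - pairing (F t) (F t)) \<le> expected_loss G"
        unfolding c_def by (rule expected_loss_subgradient[OF F_L2 G_L2])
      ultimately show ?thesis by (simp add: K_def algebra_simps)
    qed
    obtain t where "a t * (K + (\<Sum>s<t. w (Suc s))) < e"
      using boosting_recursion_gap[of L w a c K e] L_pos step_init a_nonneg step' descent K e
        expected_loss_nonneg by (auto simp: c_def)
    then show ?thesis using gap[of t] by (intro exI[of _ t]) linarith
  qed

  have risk_F: "risk M X Y \<psi> (F t) = ennreal (c t)" for t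
    by (simp add: risk_eq_expected_loss F_L2 c_def)
  have lin_L2: "G \<in> L2_X" if "G \<in> lin \<F>" for G
    using that pairing_bound_lin[OF F_L2 a_bound _ _ class_L2] unfolding lin_def by blast
  have "decseq (\<lambda>t. risk M X Y \<psi> (F t))"
  proof (rule decseq_SucI)
    fix t
    have "0 \<le> w (Suc t) * a t" by (intro mult_nonneg_nonneg w_nonneg a_nonneg)
    then show "risk M X Y \<psi> (F (Suc t)) \<le> risk M X Y \<psi> (F t)"
      unfolding risk_F using descent[of t] by (intro ennreal_leI) simp
  qed
  then have "(\<lambda>t. risk M X Y \<psi> (F t)) \<longlonglongrightarrow> (INF t. risk M X Y \<psi> (F t))"
    by (rule LIMSEQ_INF)
  moreover have "(INF t. risk M X Y \<psi> (F t)) = (INF G\<in>lin \<F>. risk M X Y \<psi> G)"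
  proof (rule antisym)
    show "(INF G\<in>lin \<F>. risk M X Y \<psi> G) \<le> (INF t. risk M X Y \<psi> (F t))"
      by (intro INF_greatest INF_lower F_lin)
    show "(INF t. risk M X Y \<psi> (F t)) \<le> (INF G\<in>lin \<F>. risk M X Y \<psi> G)"
    proof (rule INF_greatest)
      fix G assume G: "G \<in> lin \<F>"
      show "(INF t. risk M X Y \<psi> (F t)) \<le> risk M X Y \<psi> G"
        unfolding risk_eq_expected_loss[OF lin_L2[OF G]]
      proof (rule ennreal_le_epsilon)
        fix e :: real assume e: "0 < e"
        obtain t where t: "c t < expected_loss G + e"
          using near_opt[OF G e] by blast
        have "(INF t. risk M X Y \<psi> (F t)) \<le> ennreal (c t)"
          unfolding risk_F by (rule INF_lower) simp
        also have "\<dots> \<le> ennreal (expected_loss G + e)"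
          using t by (intro ennreal_leI) simp
        also have "\<dots> = ennreal (expected_loss G) + ennreal e"
          using e expected_loss_nonneg by (intro ennreal_plus) auto
        finally show "(INF t. risk M X Y \<psi> (F t)) \<le> ennreal (expected_loss G) + ennreal e" .
      qed
    qed
  qed
  ultimately show ?thesis by simp
qed

end
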